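(* Let $q,t,s_1,s_2,s_3$ be independent indeterminates. For nonnegative integers $\theta_{1,2},\theta_{1,3},\theta_{2,3}$ set $$\alpha(\theta_{1,2},\theta_{1,3},\theta_{2,3})=\frac{1-t^{-1}}{1-q^{\theta_{1,2}}t^{-1}}\cdot\frac{1-q^{\theta_{1,3}-\theta_{2,3}}t\,s_1/s_2}{1-q^{\theta_{1,3}-\theta_{2,3}}s_1/s_2}\cdot\frac{1-q^{2\theta_{1,2}+\theta_{1,3}-\theta_{2,3}+1}t^{-1}s_1/s_2}{1-q^{\theta_{1,2}+\theta_{1,3}-\theta_{2,3}+1}s_1/s_2},$$ and define $$\begin{aligned}\widetilde c(\theta_{1,2},\theta_{1,3},\theta_{2,3})={}&c(\theta_{1,2},\theta_{1,3},\theta_{2,3})-c(\theta_{1,2}-1,\theta_{1,3},\theta_{2,3})-c(\theta_{1,2},\theta_{1,3},\theta_{2,3}-1)\\&+\alpha(\theta_{1,2}-1,\theta_{1,3},\theta_{2,3}-1)\,c(\theta_{1,2}-1,\theta_{1,3},\theta_{2,3}-1)\\&-\alpha(\theta_{1,2},\theta_{1,3}-1,\theta_{2,3})\,c(\theta_{1,2},\theta_{1,3}-1,\theta_{2,3})\\&+c(\theta_{1,2}-2,\theta_{1,3},\theta_{2,3}-1)+c(\theta_{1,2},\theta_{1,3}-1,\theta_{2,3}-1)\\&-c(\theta_{1,2}-1,\theta_{1,3}-1,\theta_{2,3}-1).\end{aligned}$$ Then for all nonnegative integers $\theta_{1,2},\theta_{1,3},\theta_{2,3}$, $$\widetilde 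c(\theta_{1,2},\theta_{1,3},\theta_{2,3})=C^{(q,t)}_{\theta_{1,2}}\!\left(q^{\theta_{1,3}-\theta_{2,3}}t^{-1}s_1/s_2\right)\,C^{(q,t)}_{\theta_{1,3},\theta_{2,3}}\!\left(t^{-1}s_1/s_3,\;t^{-1}s_2/s_3\right).$$
   Context: Notation: $(a;q)_m=(1-a)(1-aq)\cdots(1-aq^{m-1})$ for integers $m\ge 0$. For nonnegative integers $\theta_{1,2},\theta_{1,3},\theta_{2,3}$, $$\begin{aligned}c(\theta_{1,2},\theta_{1,3},\theta_{2,3})={}&t^{\theta_{1,2}}\frac{(qt^{-1};q)_{\theta_{1,2}}}{(q;q)_{\theta_{1,2}}}\frac{(q^{\theta_{1,3}-\theta_{2,3}}qt^{-1}s_1/s_2;q)_{\theta_{1,2}}}{(q^{\theta_{1,3}-\theta_{2,3}}qs_1/s_2;q)_{\theta_{1,2}}}\\&\times t^{\theta_{1,3}}\frac{(qt^{-1};q)_{\theta_{1,3}}}{(q;q)_{\theta_{1,3}}}\frac{(qt^{-1}s_1/s_3;q)_{\theta_{1,3}}}{(qs_1/s_3;q)_{\theta_{1,3}}}\;t^{\theta_{2,3}}\frac{(qt^{-1};q)_{\theta_{2,3}}}{(q;q)_{\theta_{2,3}}}\frac{(qt^{-1}s_2/s_3;q)_{\theta_{2,3}}}{(qs_2/s_3;q)_{\theta_{2,3}}}\\&\times\frac{(qt^{-1}s_1/s_2;q)_{\theta_{1,3}}}{(qs_1/s_2;q)_{\theta_{1,3}}}\frac{(q^{-\theta_{2,3}}ts_1/s_2;q)_{\theta_{1,3}}}{(q^{-\theta_{2,3}}s_1/s_2;q)_{\theta_{1,3}}},\end{aligned}$$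 and $c(\theta_{1,2},\theta_{1,3},\theta_{2,3})=0$ if some $\theta_{i,j}$ is negative. A product $\alpha(\cdot)c(\cdot)$ with a negative argument is understood to be $0$. The Lassalle–Schlosser function: for $n\ge1$, indeterminates $u_1,\dots,u_n$, nonnegative integers $\theta_1,\dots,\theta_n$, and $v_k=q^{\theta_k}u_k$, $$\begin{aligned}C^{(q,t)}_{\theta_1,\dots,\theta_n}(u_1,\dots,u_n)={}&\prod_{k=1}^n t^{\theta_k}\frac{(q/t;q)_{\theta_k}}{(q;q)_{\theta_k}}\frac{(qu_k;q)_{\theta_k}}{(qtu_k;q)_{\theta_k}}\prod_{1\le i<j\le n}\frac{(qu_i/tu_j;q)_{\theta_i}}{(qu_i/u_j;q)_{\theta_i}}\frac{(tu_i/v_j;q)_{\theta_i}}{(u_i/v_j;q)_{\theta_i}}\\&\times\frac{1}{\Delta(v)}\det_{1\le i,j\le n}\left[v_i^{\,n-j}\left(1-t^{j-1}\frac{1-tv_i}{1-v_i}\prod_{k=1}^n\frac{u_k-v_i}{tu_k-v_i}\right)\right],\end{aligned}$$ where $\Delta(v)=\prod_{1\le i<j\le n}(v_i-v_j)$ and $qu_i/tu_j$ means $qu_i/(tu_j)$. *)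

theory Defs
  imports
    "HOL-Computational_Algebra.Polynomial"
    "HOL-Computational_Algebra.Fraction_Field"
    "Jordan_Normal_Form.Determinant"
begin

text \<open>
  The field \<open>k(q, t, s\<^sub>1, s\<^sub>2, s\<^sub>3)\<close> of rational functions over an arbitrary field \<open>k\<close>,
  as the fraction field of \<open>k[q][t][s\<^sub>1][s\<^sub>2][s\<^sub>3]\<close>: \<open>q\<close> is the variable of the innermost polynomial
  ring, \<open>s\<^sub>3\<close> that of the outermost.
\<close>

type_synonym 'k ratfun5 = "'k poly poly poly poly poly fract"

definition ind_q :: "'k::field ratfun5" where
  "ind_q = Fract [:[:[:[:[:0, 1:]:]:]:]:] 1"

definition ind_t :: "'k::field ratfun5" where
  "ind_t = Fract [:[:[:[:0, 1:]:]:]:] 1"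

definition ind_s1 :: "'k::field ratfun5" where
  "ind_s1 = Fract [:[:[:0, 1:]:]:] 1"

definition ind_s2 :: "'k::field ratfun5" where
  "ind_s2 = Fract [:[:0, 1:]:] 1"

definition ind_s3 :: "'k::field ratfun5" where
  "ind_s3 = Fract [:0, 1:] 1"

definition qpoch :: "'a::comm_ring_1 \<Rightarrow> 'a \<Rightarrow> nat \<Rightarrow> 'a" where
  "qpoch a q m = (\<Prod>i<m. 1 - a * q ^ i)"

text \<open>
  The coefficient \<open>c\<close>, extended by \<open>0\<close> to integer arguments at least one of which is negative.
\<close>

definition c_coeff :: "'a::field \<Rightarrow> 'a \<Rightarrow> 'a \<Rightarrow> 'a \<Rightarrow> 'a \<Rightarrow> int \<Rightarrow> int \<Rightarrow> int \<Rightarrow> 'a" where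
  "c_coeff q t s1 s2 s3 \<theta>12 \<theta>13 \<theta>23 =
    (if \<theta>12 < 0 \<or> \<theta>13 < 0 \<or> \<theta>23 < 0 then 0
     else
       t ^ nat \<theta>12 * (qpoch (q / t) q (nat \<theta>12) / qpoch q q (nat \<theta>12))
       * (qpoch (q powi (\<theta>13 - \<theta>23) * (q / t) * (s1 / s2)) q (nat \<theta>12)
          / qpoch (q powi (\<theta>13 - \<theta>23) * q * (s1 / s2)) q (nat \<theta>12))
       * t ^ nat \<theta>13 * (qpoch (q / t) q (nat \<theta>13) / qpoch q q (nat \<theta>13))
       * (qpoch ((q / t) * (s1 / s3)) q (nat \<theta>13) / qpoch (q * (s1 / s3)) q (nat \<theta>13))
       * t ^ nat \<theta>23 * (qpoch (q / t) q (nat \<theta>23) / qpoch q q (nat \<theta>23))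
       * (qpoch ((q / t) * (s2 / s3)) q (nat \<theta>23) / qpoch (q * (s2 / s3)) q (nat \<theta>23))
       * (qpoch ((q / t) * (s1 / s2)) q (nat \<theta>13) / qpoch (q * (s1 / s2)) q (nat \<theta>13))
       * (qpoch (q powi (- \<theta>23) * t * (s1 / s2)) q (nat \<theta>13)
          / qpoch (q powi (- \<theta>23) * (s1 / s2)) q (nat \<theta>13)))"

definition \<alpha>_coeff :: "'a::field \<Rightarrow> 'a \<Rightarrow> 'a \<Rightarrow> 'a \<Rightarrow> int \<Rightarrow> int \<Rightarrow> int \<Rightarrow> 'a" where
  "\<alpha>_coeff q t s1 s2 \<theta>12 \<theta>13 \<theta>23 =
     (1 - 1 / t) / (1 - q powi \<theta>12 / t)
     * ((1 - q powi (\<theta>13 - \<theta>23) * t * (s1 / s2)) / (1 - q powi (\<theta>13 - \<theta>23) * (s1 / s2)))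
     * ((1 - q powi (2 * \<theta>12 + \<theta>13 - \<theta>23 + 1) * (1 / t) * (s1 / s2))
        / (1 - q powi (\<theta>12 + \<theta>13 - \<theta>23 + 1) * (s1 / s2)))"

text \<open>
  A product of \<open>\<alpha>\<close> and \<open>c\<close> at an argument with a negative entry is \<open>0\<close>, since its
  second factor is.
\<close>

definition c_tilde :: "'a::field \<Rightarrow> 'a \<Rightarrow> 'a \<Rightarrow> 'a \<Rightarrow> 'a \<Rightarrow> int \<Rightarrow> int \<Rightarrow> int \<Rightarrow> 'a" where
  "c_tilde q t s1 s2 s3 \<theta>12 \<theta>13 \<theta>23 =
    (let c = c_coeff q t s1 s2 s3; \<alpha> = \<alpha>_coeff q t s1 s2 in
       c \<theta>12 \<theta>13 \<theta>23 - c (\<theta>12 - 1) \<theta>13 \<theta>23 - c \<theta>12 \<theta>13 (\<theta>23 - 1)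
       + \<alpha> (\<theta>12 - 1) \<theta>13 (\<theta>23 - 1) * c (\<theta>12 - 1) \<theta>13 (\<theta>23 - 1)
       - \<alpha> \<theta>12 (\<theta>13 - 1) \<theta>23 * c \<theta>12 (\<theta>13 - 1) \<theta>23
       + c (\<theta>12 - 2) \<theta>13 (\<theta>23 - 1) + c \<theta>12 (\<theta>13 - 1) (\<theta>23 - 1)
       - c (\<theta>12 - 1) (\<theta>13 - 1) (\<theta>23 - 1))"

text \<open>
  The Lassalle--Schlosser function, for lists \<open>\<theta>s\<close> and \<open>us\<close> of the same length \<open>n \<ge> 1\<close>.  Indices
  run from \<open>0\<close> to \<open>n - 1\<close>, so the usual exponents \<open>n - j\<close> and \<open>j - 1\<close> in column \<open>j\<close> of the
  determinant become \<open>n - 1 - j\<close> and \<open>j\<close>.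
\<close>

definition LS_fun :: "'a::field \<Rightarrow> 'a \<Rightarrow> nat list \<Rightarrow> 'a list \<Rightarrow> 'a" where
  "LS_fun q t \<theta>s us =
    (let n = length us;
         \<theta> = (\<lambda>k. \<theta>s ! k);
         u = (\<lambda>k. us ! k);
         v = (\<lambda>k. q ^ \<theta> k * u k)
     in
       (\<Prod>k<n. t ^ \<theta> k * (qpoch (q / t) q (\<theta> k) / qpoch q q (\<theta> k))
               * (qpoch (q * u k) q (\<theta> k) / qpoch (q * t * u k) q (\<theta> k)))
       * (\<Prod>j<n. \<Prod>i<j.
            (qpoch (q * u i / (t * u j)) q (\<theta> i) / qpoch (q * u i / u j) q (\<theta> i))
            * (qpoch (t * u i / v j) q (\<theta> i) / qpoch (u i / v j) q (\<theta> i)))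
       * (1 / (\<Prod>j<n. \<Prod>i<j. v i - v j))
       * det (mat n n (\<lambda>(i, j).
            v i ^ (n - 1 - j)
            * (1 - t ^ j * ((1 - t * v i) / (1 - v i))
                   * (\<Prod>k<n. (u k - v i) / (t * u k - v i))))))"

end

theory Submission
  imports Defs
begin

text \<open>
  Write \<open>x = s\<^sub>1/s\<^sub>2\<close>, \<open>y = s\<^sub>1/s\<^sub>3\<close>, \<open>z = s\<^sub>2/s\<^sub>3\<close>, \<open>A = q^\<theta>\<^sub>1\<^sub>2\<close>, \<open>B = q^\<theta>\<^sub>1\<^sub>3\<close>,
  \<open>C = q^\<theta>\<^sub>2\<^sub>3\<close>, \<open>Z = B x / C\<close>.  The \<open>q\<close>-Pochhammer prefactors of the two Lassalle--Schlosser
  functions multiply to exactly \<open>c(\<theta>\<^sub>1\<^sub>2, \<theta>\<^sub>1\<^sub>3, \<theta>\<^sub>2\<^sub>3)\<close>, and every shifted \<open>c\<close> is a rational function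
  of \<open>q, t, x, z, A, B, C\<close> times \<open>c(\<theta>\<^sub>1\<^sub>2, \<theta>\<^sub>1\<^sub>3, \<theta>\<^sub>2\<^sub>3)\<close>; the factors \<open>1 - A\<close>, \<open>1 - B\<close>, \<open>1 - C\<close> in these
  ratios make this true at the boundary as well.  What remains is an identity of rational functions.
  Regarded as polynomials in \<open>P = (1 - B y) / (1 - B y/t)\<close> and \<open>Q = (1 - C z) / (1 - C z/t)\<close>, whose
  coefficients involve neither \<open>y\<close> nor \<open>z\<close>, the two sides agree coefficientwise, and all four
  coefficients contain the factor coming from the one-variable determinant.
\<close>

section \<open>Independence of the five indeterminates\<close>

lemma ind_q_eq: "ind_q = Fract (monom (monom (monom (monom (monom 1 1) 0) 0) 0) 0) 1"
  and ind_t_eq: "ind_t = Fract (monom (monom (monom (monom 1 1) 0) 0) 0) 1"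
  and ind_s1_eq: "ind_s1 = Fract (monom (monom (monom 1 1) 0) 0) 1"
  and ind_s2_eq: "ind_s2 = Fract (monom (monom 1 1) 0) 1"
  and ind_s3_eq: "ind_s3 = Fract (monom 1 1) 1"
  unfolding ind_q_def ind_t_def ind_s1_def ind_s2_def ind_s3_def
  by (simp_all add: monom_altdef)

lemma Fract_power_1: "Fract p 1 ^ n = Fract (p ^ n) 1"
  by (induction n) (simp_all add: One_fract_def)

lemma Fract_mult_1: "Fract p 1 * Fract r 1 = Fract (p * r) 1"
  by simp

lemma Fract_1_eq_iff: "Fract p 1 = Fract r 1 \<longleftrightarrow> p = r"
  by (simp add: eq_fract)

lemma Fract_1_eq_0_iff: "Fract p 1 = 0 \<longleftrightarrow> p = 0"
  by (simp add: Zero_fract_def eq_fract)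

lemma monom_eq_monom_iff:
  "c \<noteq> 0 \<Longrightarrow> monom c n = monom d m \<longleftrightarrow> c = d \<and> n = m"
  by (auto simp: monom_eq_iff')

text \<open>Writing every level as a \<open>monom\<close>, with exponent \<open>0\<close> where its
  variable is absent, makes products add exponents. Distinct monomials can then be told apart level
  by level.\<close>

lemma ind_monomial:
  "(ind_q :: 'k::field ratfun5) ^ a * ind_t ^ b * ind_s1 ^ c * ind_s2 ^ d * ind_s3 ^ e =
    Fract (monom (monom (monom (monom (monom 1 a) b) c) d) e) 1"
  unfolding ind_q_eq ind_t_eq ind_s1_eq ind_s2_eq ind_s3_eq Fract_power_1 Fract_mult_1
    monom_power mult_monom
  by (simp only: power_one mult_1 mult_1_right mult_0 add_0_left add_0_right)

lemma ind_nonzero: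
  "ind_q \<noteq> 0" "ind_t \<noteq> 0" "ind_s1 \<noteq> 0" "ind_s2 \<noteq> 0" "ind_s3 \<noteq> 0"
  unfolding ind_q_eq ind_t_eq ind_s1_eq ind_s2_eq ind_s3_eq Fract_1_eq_0_iff monom_eq_0_iff
  by (rule one_neq_zero)+

text \<open>Negative powers move to the other side, so a relation with integer exponents becomes an
  equality of two monomials with natural exponents, as \<open>ind_monomial\<close> requires.\<close>

lemma powi_product_eq_1D:
  fixes x1 :: "'a::field"
  assumes "x1 \<noteq> 0" "x2 \<noteq> 0" "x3 \<noteq> 0" "x4 \<noteq> 0" "x5 \<noteq> 0"
    and "x1 powi a * x2 powi b * x3 powi c * x4 powi d * x5 powi e = 1"
  shows "x1 ^ nat a * x2 ^ nat b * x3 ^ nat c * x4 ^ nat d * x5 ^ nat e =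
    x1 ^ nat (- a) * x2 ^ nat (- b) * x3 ^ nat (- c) * x4 ^ nat (- d) * x5 ^ nat (- e)"
proof -
  have *: "x powi n = x ^ nat n / x ^ nat (- n)" if "x \<noteq> 0" for x :: 'a and n
    using that by (cases "n \<ge> 0") (auto simp: power_int_def field_simps)
  show ?thesis
    using assms(6) unfolding assms(1-5)[THEN *]
    by (simp only: times_divide_times_eq)
      (subst (asm) right_inverse_eq;
        simp only: assms(1-5) mult_eq_0_iff power_eq_0_iff simp_thms)
qed

lemma ind_independent:
  assumes "(ind_q :: 'k::field ratfun5) powi a * ind_t powi b * ind_s1 powi c * ind_s2 powi d
    * ind_s3 powi e = 1"
  shows "a = 0 \<and> b = 0 \<and> c = 0 \<and> d = 0 \<and> e = 0"
proof -
  have "nat a = nat (- a) \<and> nat b = nat (- b) \<and> nat c = nat (- c) \<and> nat d = nat (- d) \<and>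
    nat e = nat (- e)"
    using powi_product_eq_1D[OF ind_nonzero assms] unfolding ind_monomial Fract_1_eq_iff
    by (simp only: monom_eq_monom_iff monom_eq_0_iff one_neq_zero simp_thms)
  moreover have "nat n = nat (- n) \<longleftrightarrow> n = 0" for n
    by linarith
  ultimately show ?thesis
    by simp
qed

section \<open>Ratios of q-Pochhammer symbols\<close>

text \<open>Every Pochhammer quotient in the coefficient \<open>c\<close> has this shape or is the
  inverse of one.\<close>

definition qratio :: "'a::field \<Rightarrow> 'a \<Rightarrow> 'a \<Rightarrow> nat \<Rightarrow> 'a" where
  "qratio q t a n = qpoch (a / t) q n / qpoch a q n"

lemma qpoch_Suc: "qpoch a q (Suc n) = qpoch a q n * (1 - a * q ^ n)"
  by (simp add: qpoch_def)

lemma qpoch_Suc_shift: "qpoch a q (Suc n) = (1 - a) * qpoch (a * q) q n"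
  unfolding qpoch_def prod.lessThan_Suc_shift by (simp add: mult.assoc)

lemma qratio_Suc: "qratio q t a (Suc n) = qratio q t a n * ((1 - a * q ^ n / t) / (1 - a * q ^ n))"
  by (simp add: qratio_def qpoch_Suc)

text \<open>Both \<open>(1 - a) * qpoch (a * q) q n\<close> and
  \<open>qpoch a q n * (1 - a * q ^ n)\<close> equal \<open>qpoch a q (Suc n)\<close>. This handles
  the factors of \<open>c\<close> whose base argument moves under a shift.\<close>

lemma qratio_shift:
  assumes "a \<noteq> 1" "a \<noteq> t" "t \<noteq> 0"
  shows "qratio q t (a * q) n =
    qratio q t a n * ((1 - a * q ^ n / t) * (1 - a) / ((1 - a / t) * (1 - a * q ^ n)))"
proof -
  have *: "qpoch (b * q) q n = qpoch b q n * (1 - b * q ^ n) / (1 - b)" if "b \<noteq> 1" for b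
    using qpoch_Suc[of b q n] qpoch_Suc_shift[of b q n] that by (simp add: field_simps)
  show ?thesis
    using *[of a] *[of "a / t"] assms by (simp add: qratio_def mult_ac)
qed

section \<open>The determinant of order two and two rational identities\<close>

lemma det_2x2:
  assumes "A \<in> carrier_mat 2 2"
  shows "det A = A $$ (0, 0) * A $$ (1, 1) - A $$ (0, 1) * A $$ (1, 0)"
proof -
  have "det A = (\<Sum>i<2. A $$ (i, 0) * cofactor A i 0)"
    using laplace_expansion_column[OF assms, of 0] by simp
  moreover have "det (mat_delete A 0 0) = A $$ (1, 1)" "det (mat_delete A 1 0) = A $$ (0, 1)"
    using assms by (subst det_single; simp add: mat_delete_def)+
  ultimately show ?thesis
    by (simp add: numeral_2_eq_2 cofactor_def)
qed

(* The method name is qualified because HOL-Algebra, imported through the matrix theories,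
   redefines algebra. *)
lemma shift12_ratio_identity:
  fixes t :: "'a::field"
  assumes "t \<noteq> A" "t \<noteq> A * Z"
  shows "1 - t * (1 - A) * (1 - A * Z) / ((t - A) * (t - A * Z))
    = (t - 1) * (t - A^2 * Z) / ((t - A) * (t - A * Z))"
proof -
  have "(t - A) * (t - A * Z) \<noteq> 0"
    using assms by simp
  moreover have "(t - A) * (t - A * Z) - t * (1 - A) * (1 - A * Z) = (t - 1) * (t - A^2 * Z)"
    by Groebner_Basis.algebra
  ultimately show ?thesis
    by (simp add: diff_divide_eq_iff)
qed

text \<open>The first factor comes from lowering the last argument of \<open>c\<close>. The bracket
  combines the terms with that lowered argument and first arguments \<open>m\<close>,
  \<open>m - 1\<close>, \<open>m - 2\<close>. The result is the same factor as in
  \<open>shift12_ratio_identity\<close>.\<close>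

lemma shift23_ratio_identity:
  fixes q :: "'a::field"
  assumes "t \<noteq> 0" "t \<noteq> A" "q * t \<noteq> A" "t \<noteq> A * Z" "t \<noteq> q * A * Z"
    and "t \<noteq> q * Z" "q * Z \<noteq> 1" "q * A * Z \<noteq> 1"
  shows "(t - q * A * Z) * (1 - q * Z) / ((t - q * Z) * (1 - q * A * Z))
    * (1 - (t - 1) * q / (q * t - A) * ((1 - q * t * Z) / (1 - q * Z))
          * ((t - A^2 * Z) / (t * (1 - q * A * Z)))
          * (t * (1 - A) * (1 - q * A * Z) / ((t - A) * (t - q * A * Z)))
       - t * (q - A) * (1 - A * Z) / ((q * t - A) * (t - A * Z))
          * (t * (1 - A) * (1 - q * A * Z) / ((t - A) * (t - q * A * Z))))
    = (t - 1) * (t - A^2 * Z) / ((t - A) * (t - A * Z))"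
proof -
  define a b c d e f g where d: "a = t - A" "b = q * t - A" "c = t - A * Z"
    "d = t - q * A * Z" "e = t - q * Z" "f = 1 - q * Z" "g = 1 - q * A * Z"
  define r p where rp: "r = 1 - q * t * Z" "p = 1 - A * Z"
  define k w where kw: "k = t * (1 - A) * p" "w = (t - 1) * (t - A^2 * Z)"
  define x y where xy: "x = w * q * r * (1 - A)" "y = k * t * (q - A)"
  have n: "a \<noteq> 0" "b \<noteq> 0" "c \<noteq> 0" "d \<noteq> 0" "e \<noteq> 0" "f \<noteq> 0" "g \<noteq> 0"
    using assms by (auto simp: d)
  \<comment> \<open>These relations avoid expanding the whole numerator. Replacing
    \<open>a * c\<close> by \<open>w + k\<close> splits it into a multiple of \<open>w\<close> and a
    multiple of \<open>k\<close>, relations \<open>2\<close> and \<open>3\<close> extract the common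
    factor \<open>w * q * (1 - A)\<close>, and \<open>4\<close> makes the rest vanish.\<close>
  have 1: "a * c = w + k" and 2: "b * d - t * (q - A) * g = w * q"
    and 3: "d * f - e * g = q * Z * (1 - A) * (1 - t)"
    and 4: "b * (Z * (1 - t)) - r * c + t * p * f = 0"
    unfolding d kw rp by Groebner_Basis.algebra+
  have "a * b * c * d * f - x * c - y * f * g - w * e * g * b =
     (a * c) * (b * d * f) - w * q * r * (1 - A) * c - k * t * (q - A) * f * g - w * e * g * b"
    unfolding xy by (simp add: mult_ac)
  also have "\<dots> = w * (b * (d * f - e * g) - q * r * (1 - A) * c) + k * f * (b * d - t * (q - A) * g)"
    unfolding 1 by Groebner_Basis.algebra
  also have "\<dots> = w * q * (1 - A) * (b * (Z * (1 - t)) - r * c + t * p * f)"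
    unfolding 2 3 kw(1) by Groebner_Basis.algebra
  finally have *: "a * b * c * d * f - x * c - y * f * g = w * e * g * b"
    unfolding 4 by simp
  have "1 - x / (b * f * a * d) - y * g / (b * c * a * d) =
     a * b * c * d * f / (a * b * c * d * f) - x * c / (a * b * c * d * f)
       - y * f * g / (a * b * c * d * f)"
    using n by (simp add: mult_ac)
  then have "d * f / (e * g) * (1 - x / (b * f * a * d) - y * g / (b * c * a * d)) =
     d * f / (e * g) * ((a * b * c * d * f - x * c - y * f * g) / (a * b * c * d * f))"
    by (simp only: diff_divide_distrib)
  also have "\<dots> = (a * b * c * d * f - x * c - y * f * g) / (a * b * c * e * g)"
    using n by simp
  also have "\<dots> = w / (a * c)"
    unfolding * using n by simp
  finally show ?thesis
    using n assms(1) unfolding d[symmetric] kw rp xy by (simp add: mult_ac power2_eq_square)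
qed

section \<open>The Lassalle--Schlosser functions in one and two variables\<close>

lemma LS_fun_1:
  fixes q t u :: "'a::field" and m :: nat
  defines "v \<equiv> q ^ m * u"
  shows "LS_fun q t [m] [u] = t ^ m * (qpoch (q / t) q m / qpoch q q m)
    * (qpoch (q * u) q m / qpoch (q * t * u) q m)
    * (1 - (1 - t * v) / (1 - v) * ((u - v) / (t * u - v)))"
proof -
  have "det (mat 1 1 f) = f (0, 0)" for f :: "nat \<times> nat \<Rightarrow> 'a"
    by (simp add: det_single)
  moreover have "length [u] = 1" "[u] ! 0 = u" "[m] ! 0 = m"
    by simp_all
  moreover have "(\<Prod>k<1. f k) = f 0" "(\<Prod>j<1. \<Prod>i<j. h i j) = 1"
    for f :: "nat \<Rightarrow> 'a" and h :: "nat \<Rightarrow> nat \<Rightarrow> 'a"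
    by simp_all
  ultimately show ?thesis
    unfolding LS_fun_def v_def Let_def by (simp only: prod.case) (simp add: mult_ac)
qed

text \<open>The rows of the determinant are \<open>(v * (1 - g v), 1 - t * g v)\<close> for
  \<open>v = v1, v2\<close>.\<close>

lemma LS_fun_2:
  fixes q t u1 u2 :: "'a::field" and a b :: nat
  defines "v1 \<equiv> q ^ a * u1" and "v2 \<equiv> q ^ b * u2"
  defines "g \<equiv> \<lambda>v. (1 - t * v) / (1 - v) * ((u1 - v) / (t * u1 - v) * ((u2 - v) / (t * u2 - v)))"
  shows "LS_fun q t [a, b] [u1, u2] =
    t ^ a * (qpoch (q / t) q a / qpoch q q a) * (qpoch (q * u1) q a / qpoch (q * t * u1) q a)
    * (t ^ b * (qpoch (q / t) q b / qpoch q q b) * (qpoch (q * u2) q b / qpoch (q * t * u2) q b))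
    * ((qpoch (q * u1 / (t * u2)) q a / qpoch (q * u1 / u2) q a)
       * (qpoch (t * u1 / v2) q a / qpoch (u1 / v2) q a))
    * ((v1 * (1 - g v1) * (1 - t * g v2) - v2 * (1 - g v2) * (1 - t * g v1)) / (v1 - v2))"
proof -
  have "det (mat 2 2 f) = f (0, 0) * f (1, 1) - f (0, 1) * f (1, 0)" for f :: "nat \<times> nat \<Rightarrow> 'a"
    by (simp add: det_2x2)
  moreover have "length [u1, u2] = 2" "[u1, u2] ! 0 = u1" "[u1, u2] ! 1 = u2"
    "[a, b] ! 0 = a" "[a, b] ! 1 = b"
    by simp_all
  moreover have "(\<Prod>k<2. f k) = f 0 * f 1" "(\<Prod>j<2. \<Prod>i<j. h i j) = h 0 1"
    for f :: "nat \<Rightarrow> 'a" and h :: "nat \<Rightarrow> nat \<Rightarrow> 'a"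
    by (simp_all add: numeral_2_eq_2)
  ultimately show ?thesis
    unfolding LS_fun_def v1_def v2_def g_def Let_def by (simp only: prod.case) (simp add: mult_ac)
qed

section \<open>Multiplicatively independent parameters\<close>

text \<open>\<open>x\<close>, \<open>y\<close>, \<open>z\<close> stand for \<open>s1 / s2\<close>,
  \<open>s1 / s3\<close>, \<open>s2 / s3\<close>, through which alone the \<open>s\<close> variables
  enter; hence \<open>y = x * z\<close>. Genericity is used as the absence of monomial relations
  between \<open>q\<close>, \<open>t\<close>, \<open>x\<close>, \<open>z\<close>.\<close>

locale generic_parameters =
  fixes q t x y z :: "'a::field"
  assumes nonzero: "q \<noteq> 0" "t \<noteq> 0" "x \<noteq> 0" "z \<noteq> 0"
    and independent: "q powi a * t powi b * x powi c * z powi d = 1 \<Longrightarrow>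
      a = 0 \<and> b = 0 \<and> c = 0 \<and> d = 0"
    and y_eq: "y = x * z"
begin

lemma q_powi_add: "q powi (m + n) = q powi m * q powi n"
  using nonzero by (simp add: power_int_add)

text \<open>Equality in any line would be a monomial relation with a nonzero exponent. These facts
  keep the denominators in the shift formulas from vanishing.\<close>

lemma q_powi_neq:
  "q powi n \<noteq> t"
  "q powi n \<noteq> x"
  "q powi n \<noteq> t * x"
  "n \<noteq> 0 \<Longrightarrow> q powi n \<noteq> 1"
  "q powi n * x \<noteq> 1"
  "q powi n * x \<noteq> t"
  "t * (q powi n * x) \<noteq> 1"
  "q powi n * y \<noteq> 1"
  "q powi n * y \<noteq> t"
  "q powi n * z \<noteq> 1"
  "q powi n * z \<noteq> t"
  using independent[of n "- 1" 0 0] independent[of n 0 "- 1" 0] independent[of n "- 1" "- 1" 0]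
    independent[of n 0 0 0] independent[of n 0 1 0] independent[of n "- 1" 1 0]
    independent[of n 1 1 0] independent[of n 0 1 1] independent[of n "- 1" 1 1]
    independent[of n 0 0 1] independent[of n "- 1" 0 1] nonzero
  by (auto simp: y_eq field_simps)

section \<open>The coefficient and its three shifts\<close>

text \<open>The last quotient of the coefficient, with \<open>t\<close> in its numerator, becomes an
  inverse \<open>qratio\<close> with base argument \<open>t * x * q powi (- int b)\<close>.\<close>

definition c_nat :: "nat \<Rightarrow> nat \<Rightarrow> nat \<Rightarrow> 'a" where
  "c_nat m a b = t ^ (m + a + b)
     * (qratio q t q m * qratio q t (q powi (int a - int b) * x * q) m)
     * (qratio q t q a * qratio q t (y * q) a * qratio q t (x * q) a
        / qratio q t (t * x * q powi (- int b)) a)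
     * (qratio q t q b * qratio q t (z * q) b)"

definition c :: "int \<Rightarrow> int \<Rightarrow> int \<Rightarrow> 'a" where
  "c m a b = (if m < 0 \<or> a < 0 \<or> b < 0 then 0 else c_nat (nat m) (nat a) (nat b))"

text \<open>Only the two ratios of length \<open>m\<close> change, each by its last factor. At
  \<open>m = 0\<close> the factor \<open>1 - A\<close> vanishes, in agreement with the extension of
  \<open>c\<close> by zero.\<close>

lemma c_shift12:
  fixes m a b :: int
  defines "A \<equiv> q powi m" and "Z \<equiv> q powi (a - b) * x"
  shows "c (m - 1) a b = t * (1 - A) * (1 - A * Z) / ((t - A) * (t - A * Z)) * c m a b"
proof (cases "m \<le> 0 \<or> a < 0 \<or> b < 0")
  case True
  then show ?thesis
    by (auto simp: c_def A_def)
next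
  case False
  then obtain n k l where mab: "m = 1 + int n" "a = int k" "b = int l"
    by (metis linorder_not_le nonneg_int_cases zle_iff_zadd zless_imp_add1_zle add_0)
  have A: "A = q * q ^ n"
    by (simp add: A_def mab q_powi_add)
  have AZ: "A * Z = Z * q * q ^ n"
    by (simp add: A)
  have n: "A \<noteq> 1" "A \<noteq> t" "A * Z \<noteq> 1" "A * Z \<noteq> t"
    using q_powi_neq(1)[of m] q_powi_neq(4)[of m] q_powi_neq(5,6)[of "m + (a - b)"] mab
    by (simp_all add: A_def Z_def q_powi_add mult.assoc)
  have "c_nat (Suc n) k l =
      c_nat n k l * (t * ((1 - A / t) / (1 - A)) * ((1 - A * Z / t) / (1 - A * Z)))"
    unfolding c_nat_def qratio_Suc AZ unfolding A Z_def by (simp add: mab mult_ac)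
  also have "\<dots> = c_nat n k l * ((t - A) * (t - A * Z) / (t * (1 - A) * (1 - A * Z)))"
  proof -
    have *: "1 - u / t = (t - u) / t" for u
      using nonzero by (simp add: diff_divide_distrib)
    show ?thesis
      unfolding * using nonzero by (simp add: mult_ac)
  qed
  finally show ?thesis
    using n nonzero by (simp add: c_def mab nat_add_distrib)
qed

text \<open>Besides shortening the ratios of length \<open>a\<close>, the shift divides
  \<open>Z\<close> by \<open>q\<close>; \<open>qratio_shift\<close> accounts for this in the ratio
  of length \<open>m\<close>. The factor \<open>1 - B\<close> covers \<open>a = 0\<close>.\<close>

lemma c_shift13:
  fixes m a b :: int
  defines "A \<equiv> q powi m" and "B \<equiv> q powi a" and "Z \<equiv> q powi (a - b) * x"
  shows "c m (a - 1) b = t * (1 - B) * (1 - B * x) / ((t - B) * (t - B * x))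
     * ((1 - B * y) / (t - B * y)) * t
     * ((t - Z) * (1 - A * Z) * (q - Z) / ((t - A * Z) * (1 - Z) * (q - t * Z))) * c m a b"
proof (cases "m < 0 \<or> a \<le> 0 \<or> b < 0")
  case True
  then show ?thesis
    by (auto simp: c_def B_def)
next
  case False
  then obtain n k l where mab: "m = int n" "a = 1 + int k" "b = int l"
    by (metis linorder_not_le nonneg_int_cases zle_iff_zadd zless_imp_add1_zle add_0)
  have A: "A = q ^ n"
    by (simp add: A_def mab)
  have B: "B = q * q ^ k"
    by (simp add: B_def mab q_powi_add)
  have Z: "Z = q powi (int k - int l) * x * q" "Z = q powi (int (Suc k) - int l) * x"
    by (simp_all add: Z_def mab q_powi_add power_int_diff nonzero)
  \<comment> \<open>This monomial belongs to the last factor of the inverted ratio of length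
    \<open>k + 1\<close>, whose base argument does not depend on \<open>a\<close>.\<close>
  have w: "t * x * q powi (- int l) * q ^ k = t * Z / q"
    using nonzero by (simp add: Z(1) power_int_diff power_int_minus divide_inverse)
  have n: "B \<noteq> 1" "B \<noteq> t" "B * x \<noteq> 1" "B * x \<noteq> t" "B * y \<noteq> 1" "B * y \<noteq> t"
    "Z \<noteq> 1" "Z \<noteq> t" "A * Z \<noteq> 1" "A * Z \<noteq> t" "q \<noteq> Z" "q \<noteq> t * Z"
    using q_powi_neq(1,5,6,8,9)[of a] q_powi_neq(4)[of a] q_powi_neq(5,6)[of "m + (a - b)"]
      q_powi_neq(5,6)[of "a - b"] q_powi_neq(5,7)[of "a - b - 1"] mab nonzero
    by (simp_all add: A_def B_def Z_def q_powi_add mult.assoc power_int_diff field_simps)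
  have "c_nat n (Suc k) l = c_nat n k l *
      (t * ((1 - Z * A / t) * (1 - Z) / ((1 - Z / t) * (1 - Z * A)))
       * ((1 - B / t) / (1 - B)) * ((1 - y * B / t) / (1 - y * B)) * ((1 - x * B / t) / (1 - x * B))
       / ((1 - t * Z / q / t) / (1 - t * Z / q)))"
    unfolding c_nat_def qratio_Suc w Z(2)[symmetric] Z(1)[symmetric] qratio_shift[OF n(7,8) nonzero(2)]
    unfolding A B by (simp add: mult_ac)
  also have "\<dots> = c_nat n k l *
     (1 / (t * (1 - B) * (1 - B * x) / ((t - B) * (t - B * x))
     * ((1 - B * y) / (t - B * y)) * t
     * ((t - Z) * (1 - A * Z) * (q - Z) / ((t - A * Z) * (1 - Z) * (q - t * Z)))))"
  proof -
    have *: "1 - u / t = (t - u) / t" "1 - u / q = (q - u) / q" for u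
      using nonzero by (simp_all add: diff_divide_distrib)
    have **: "t * Z / q / t = Z / q"
      using nonzero by simp
    show ?thesis
      unfolding ** * using nonzero by (simp add: mult_ac)
  qed
  finally show ?thesis
    using n nonzero by (simp add: c_def mab nat_add_distrib)
qed

text \<open>Two base arguments move: one in a ratio of length \<open>m\<close>, through
  \<open>Z\<close>, and that of the inverted ratio of length \<open>a\<close>. Each is corrected by
  \<open>qratio_shift\<close>. The factor \<open>1 - C\<close> covers \<open>b = 0\<close>.\<close>

lemma c_shift23:
  fixes m a b :: int
  defines "A \<equiv> q powi m" and "C \<equiv> q powi b" and "Z \<equiv> q powi (a - b) * x"
  shows "c m a (b - 1) = (1 - C) * (C - x) / ((t - C) * (C - t * x))
     * (t * (1 - C * z) / (t - C * z)) * ((1 - t * Z) / (1 - Z))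
     * ((t - q * A * Z) * (1 - q * Z) / ((t - q * Z) * (1 - q * A * Z))) * c m a b"
proof (cases "m < 0 \<or> a < 0 \<or> b \<le> 0")
  case True
  then show ?thesis
    by (auto simp: c_def C_def)
next
  case False
  then obtain n k l where mab: "m = int n" "a = int k" "b = 1 + int l"
    by (metis linorder_not_le nonneg_int_cases zle_iff_zadd zless_imp_add1_zle add_0)
  have A: "A = q ^ n"
    by (simp add: A_def mab)
  have C: "C = q * q ^ l"
    by (simp add: C_def mab q_powi_add)
  have Z: "q * Z = q powi (int k - int l) * x" "q * Z = q powi (int k - int (Suc l)) * x * q"
    by (simp_all add: Z_def mab q_powi_add power_int_diff nonzero)
  have "b \<noteq> 0"
    using mab by simp
  define w where "w = t * x / C"
  have w: "w = t * x * q powi (- int (Suc l))" "w * q = t * x * q powi (- int l)"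
    "w * q ^ k = t * Z"
    unfolding w_def
    using nonzero by (simp_all add: Z_def mab C power_int_add power_int_diff power_int_minus divide_inverse)
  have n: "C \<noteq> 1" "C \<noteq> t" "C * z \<noteq> 1" "C * z \<noteq> t" "C \<noteq> x" "C \<noteq> t * x"
    "Z \<noteq> 1" "t * Z \<noteq> 1" "q * Z \<noteq> 1" "q * Z \<noteq> t" "q * A * Z \<noteq> 1" "q * A * Z \<noteq> t"
    using q_powi_neq(1,2,3,10,11)[of b] q_powi_neq(4)[of b] q_powi_neq(5,7)[of "a - b"]
      q_powi_neq(5,6)[of "1 + (a - b)"] q_powi_neq(5,6)[of "1 + (m + (a - b))"] \<open>b \<noteq> 0\<close>
    by (simp_all add: A_def C_def Z_def q_powi_add mult.assoc)
  have w_neq: "w \<noteq> 1" "w \<noteq> t" "C \<noteq> 0"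
    using n nonzero by (auto simp: w_def C field_simps)
  \<comment> \<open>Both corrections come from expanding \<open>c_nat n k l\<close>, where the two
    base arguments are \<open>q\<close> times those of \<open>c_nat n k (Suc l)\<close>. One ratio
    stands in the numerator and the other in the denominator, so the corrections end up on opposite
    sides.\<close>
  have "c_nat n k (Suc l) * ((1 - q * Z * A / t) * (1 - q * Z) / ((1 - q * Z / t) * (1 - q * Z * A)))
      = c_nat n k l * (t * ((1 - C / t) / (1 - C)) * ((1 - z * C / t) / (1 - z * C))
       * ((1 - t * Z / t) * (1 - w) / ((1 - w / t) * (1 - t * Z))))"
    unfolding c_nat_def qratio_Suc w(1)[symmetric] w(2)[symmetric] Z(1)[symmetric] Z(2)[symmetric]
      qratio_shift[OF n(9,10) nonzero(2)] qratio_shift[OF w_neq(1,2) nonzero(2)] w(3)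
    using n w_neq nonzero
    unfolding A C by (simp add: mult_ac)
  moreover have *: "1 - u / t = (t - u) / t" for u
    using nonzero by (simp_all add: diff_divide_distrib)
  moreover have **: "1 - w = (C - t * x) / C" "1 - w / t = (C - x) / C" "t * Z / t = Z"
    using nonzero w_neq by (simp_all add: diff_divide_distrib w_def)
  define R S where RS: "R = (1 - C) * (C - x) / ((t - C) * (C - t * x))
     * (t * (1 - C * z) / (t - C * z)) * ((1 - t * Z) / (1 - Z))"
    "S = (t - q * A * Z) * (1 - q * Z) / ((t - q * Z) * (1 - q * A * Z))"
  ultimately have "c_nat n k (Suc l) * S = c_nat n k l * (1 / R)"
    unfolding ** unfolding * RS using nonzero w_neq by (simp add: mult_ac)
  moreover have "R \<noteq> 0"
    using n nonzero by (simp add: RS)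
  ultimately have "c_nat n k l = R * S * c_nat n k (Suc l)"
    by (simp add: nonzero_eq_divide_eq mult_ac)
  then show ?thesis
    unfolding RS by (simp add: c_def mab nat_add_distrib)
qed

section \<open>The determinants in terms of \<open>A\<close>, \<open>B\<close>, \<open>C\<close>,
  \<open>Z\<close>\<close>

text \<open>The one-variable determinant at \<open>u = Z / t\<close>, \<open>v = A * Z / t\<close>.
  By \<open>shift12_ratio_identity\<close> it is also \<open>1\<close> minus the ratio in
  \<open>c_shift12\<close>.\<close>

definition LS_det1 :: "'a \<Rightarrow> 'a \<Rightarrow> 'a" where
  "LS_det1 A Z = (t - 1) * (t - A^2 * Z) / ((t - A) * (t - A * Z))"

lemma LS_fun_1_eq:
  fixes m :: nat and n :: int
  defines "Z \<equiv> q powi n * x"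
  shows "LS_fun q t [m] [Z / t] =
    t ^ m * qratio q t q m * qratio q t (Z * q) m * LS_det1 (q ^ m) Z"
proof -
  define A where "A = q ^ m"
  have n: "t \<noteq> A" "t \<noteq> A * Z" "Z \<noteq> 0"
    using q_powi_neq(1)[of "int m"] q_powi_neq(6)[of "int m + n"] nonzero
    by (auto simp: A_def Z_def q_powi_add mult.assoc)
  have "(1 - t * (A * (Z / t))) / (1 - A * (Z / t)) = t * (1 - A * Z) / (t - A * Z)"
    using nonzero n by (simp add: divide_simps)
  moreover have "(Z / t - A * (Z / t)) / (t * (Z / t) - A * (Z / t)) = (1 - A) / (t - A)"
  proof -
    have h: "r - s * r = r * (1 - s)" "t * r - s * r = r * (t - s)" for r s
      by (simp_all add: algebra_simps)
    have "Z / t - A * (Z / t) = (Z / t) * (1 - A)" "t * (Z / t) - A * (Z / t) = (Z / t) * (t - A)"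
      by (rule h)+
    then show ?thesis
      using n nonzero by simp
  qed
  ultimately have "1 - (1 - t * (A * (Z / t))) / (1 - A * (Z / t))
      * ((Z / t - A * (Z / t)) / (t * (Z / t) - A * (Z / t))) = LS_det1 A Z"
    using shift12_ratio_identity[OF n(1,2)] by (simp add: LS_det1_def mult_ac)
  then show ?thesis
    unfolding LS_fun_1 A_def[symmetric] using nonzero by (simp add: qratio_def mult_ac)
qed

text \<open>\<open>eta1\<close> and \<open>eta2\<close> are the values of \<open>g\<close> from
  \<open>LS_fun_2\<close> at \<open>v1 = B * y / t\<close> and \<open>v2 = C * z / t\<close>. They
  are \<open>P\<close> and \<open>Q\<close> times factors free of \<open>y\<close> and
  \<open>z\<close>.\<close>

definition eta1 :: "'a \<Rightarrow> 'a" where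
  "eta1 B = t * (1 - B) * (1 - B * x) / ((t - B) * (t - B * x)) * ((1 - B * y) / (t - B * y))"

definition eta2 :: "'a \<Rightarrow> 'a" where
  "eta2 C = (1 - C) * (C - x) / ((t - C) * (C - t * x)) * (t * (1 - C * z) / (t - C * z))"

text \<open>The two-variable determinant divided by \<open>v1 - v2\<close>, expanded in
  \<open>1\<close>, \<open>eta1\<close>, \<open>eta2\<close>, \<open>eta1 * eta2\<close>; of
  \<open>v1\<close> and \<open>v2\<close> themselves only the quotient \<open>Z\<close> remains in
  the coefficients.\<close>

definition LS_det2 :: "'a \<Rightarrow> 'a \<Rightarrow> 'a \<Rightarrow> 'a" where
  "LS_det2 B C Z =
    1 - eta1 B * ((t - Z) / (1 - Z)) - eta2 C * ((1 - t * Z) / (1 - Z)) + t * eta1 B * eta2 C"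

lemma LS_fun_2_eq:
  fixes a b :: nat
  defines "Z \<equiv> q powi (int a - int b) * x"
  shows "LS_fun q t [a, b] [y / t, z / t] =
    t ^ a * t ^ b * (qratio q t q a * qratio q t (y * q) a * qratio q t (x * q) a
        / qratio q t (t * x * q powi (- int b)) a)
     * (qratio q t q b * qratio q t (z * q) b) * LS_det2 (q ^ a) (q ^ b) Z"
proof -
  define B C k where BC: "B = q ^ a" "C = q ^ b" "k = z / t"
  have n: "B \<noteq> t" "B * y \<noteq> t" "B * x \<noteq> t" "C \<noteq> t" "C * z \<noteq> t" "C \<noteq> x" "C \<noteq> t * x" "Z \<noteq> 1"
    "C \<noteq> 0" "k \<noteq> 0" "y \<noteq> 0"
    using q_powi_neq(1,6,9)[of "int a"] q_powi_neq(1,2,3,11)[of "int b"]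
      q_powi_neq(5)[of "int a - int b"] nonzero
    by (auto simp: BC Z_def y_eq)
  define g where "g v = (1 - t * v) / (1 - v)
      * ((y / t - v) / (t * (y / t) - v) * ((z / t - v) / (t * (z / t) - v)))"
    for v
  have k: "z / t = k" "y / t = k * x"
    by (simp_all add: BC y_eq)
  \<comment> \<open>Both nodes are multiples of \<open>k * C\<close> with quotient \<open>Z\<close>,
    so \<open>k * C\<close> cancels between the determinant and the Vandermonde factor.\<close>
  have v: "B * (y / t) = k * C * Z" "C * (z / t) = k * C"
    using nonzero by (simp_all add: BC Z_def y_eq power_int_diff)
  have h: "r - s * r = r * (1 - s)" "t * r - s * r = r * (t - s)" for r s
    by (simp_all add: algebra_simps)
  have g1: "g (B * (y / t)) = eta1 B"
  proof -
    have "(1 - t * (B * (y / t))) / (1 - B * (y / t)) = t * (1 - B * y) / (t - B * y)"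
      using nonzero n by (simp add: divide_simps)
    moreover have "y / t - B * (y / t) = (y / t) * (1 - B)"
      "t * (y / t) - B * (y / t) = (y / t) * (t - B)"
      by (rule h)+
    moreover have "z / t - B * (y / t) = k * (1 - B * x)"
      "t * (z / t) - B * (y / t) = k * (t - B * x)"
      unfolding k by (simp_all add: left_diff_distrib right_diff_distrib mult_ac)
    ultimately show ?thesis
      unfolding g_def eta1_def using n nonzero by (simp add: mult_ac)
  qed
  have g2: "g (C * (z / t)) = eta2 C"
  proof -
    have "(1 - t * (C * (z / t))) / (1 - C * (z / t)) = t * (1 - C * z) / (t - C * z)"
      using nonzero n by (simp add: divide_simps)
    moreover have "z / t - C * (z / t) = k * (1 - C)" "t * (z / t) - C * (z / t) = k * (t - C)"
      unfolding k by (rule h)+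
    moreover have "y / t - C * (z / t) = (- k) * (C - x)"
      "t * (y / t) - C * (z / t) = (- k) * (C - t * x)"
      unfolding k by (simp_all add: left_diff_distrib right_diff_distrib mult_ac)
    moreover have "- k * (C - x) / (- k * (C - t * x)) = (C - x) / (C - t * x)"
      using n by simp
    ultimately show ?thesis
      unfolding g_def eta2_def using n nonzero by (simp add: mult_ac)
  qed
  have D: "(k * C * Z * (1 - eta1 B) * (1 - t * eta2 C) - k * C * (1 - eta2 C) * (1 - t * eta1 B))
      / (k * C * Z - k * C)
    = LS_det2 B C Z"
  proof -
    have "k * C * Z * (1 - eta1 B) * (1 - t * eta2 C) - k * C * (1 - eta2 C) * (1 - t * eta1 B)
      = (k * C) * (Z * (1 - eta1 B) * (1 - t * eta2 C) - (1 - eta2 C) * (1 - t * eta1 B))"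
      "k * C * Z - k * C = (k * C) * (Z - 1)"
      by Groebner_Basis.algebra+
    then have "(k * C * Z * (1 - eta1 B) * (1 - t * eta2 C) - k * C * (1 - eta2 C) * (1 - t * eta1 B))
      / (k * C * Z - k * C)
      = (Z * (1 - eta1 B) * (1 - t * eta2 C) - (1 - eta2 C) * (1 - t * eta1 B)) / (Z - 1)"
      using n by simp
    also have "\<dots> = LS_det2 B C Z"
    proof -
      have "Z * (1 - eta1 B) * (1 - t * eta2 C) - (1 - eta2 C) * (1 - t * eta1 B)
        = - ((1 - Z) - eta1 B * (t - Z) - eta2 C * (1 - t * Z) + t * eta1 B * eta2 C * (1 - Z))"
        by Groebner_Basis.algebra
      then have "(Z * (1 - eta1 B) * (1 - t * eta2 C) - (1 - eta2 C) * (1 - t * eta1 B)) / (Z - 1)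
        = ((1 - Z) - eta1 B * (t - Z) - eta2 C * (1 - t * Z) + t * eta1 B * eta2 C * (1 - Z)) / (1 - Z)"
        by (metis minus_diff_eq minus_divide_divide)
      also have "\<dots> = LS_det2 B C Z"
      proof -
        have "(d - r * f - s * g + h * d) / d = 1 - r * (f / d) - s * (g / d) + h" if "d \<noteq> 0"
          for d f g h r s :: 'a
          using that by (simp add: add_divide_distrib diff_divide_distrib)
        then show ?thesis
          using n by (simp add: LS_det2_def)
      qed
      finally show ?thesis .
    qed
    finally show ?thesis .
  qed
  have args: "q * (y / t) = y * q / t" "q * t * (y / t) = y * q" "q * (z / t) = z * q / t"
    "q * t * (z / t) = z * q" "q * (y / t) / (t * (z / t)) = x * q / t" "q * (y / t) / (z / t) = x * q"
    "t * (y / t) / (C * (z / t)) = t * x * q powi (- int b)"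
    "y / t / (C * (z / t)) = t * x * q powi (- int b) / t"
    using nonzero by (simp_all add: y_eq BC power_int_minus field_simps)
  show ?thesis
    unfolding LS_fun_2 BC(1,2)[symmetric] g_def[symmetric] g1 g2 args(5-8)
    unfolding args(1-4) v D using nonzero by (simp add: qratio_def mult_ac)
qed

section \<open>Combining the shifted coefficients\<close>

lemma c_coeff_eq:
  assumes "x = s1 / s2" "y = s1 / s3" "z = s2 / s3"
  shows "c_coeff q t s1 s2 s3 = c"
proof (intro ext)
  fix m a b
  show "c_coeff q t s1 s2 s3 m a b = c m a b"
    unfolding c_coeff_def c_def c_nat_def assms(1-3)[symmetric] qratio_def
    using nonzero by (auto simp: power_add mult_ac)
qed

text \<open>The eight terms fall into four groups, each carrying the factor \<open>w\<close>. The
  first two terms give the coefficient of \<open>1\<close>, the three with \<open>a\<close> and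
  \<open>b - 1\<close> that of \<open>eta2\<close>, the one with \<open>a - 1\<close> and
  \<open>b\<close> that of \<open>eta1\<close>, and the last two that of
  \<open>eta1 * eta2\<close>.\<close>

lemma c_combination:
  fixes m a b :: int
  defines "\<alpha> \<equiv> \<lambda>m a b. (1 - 1 / t) / (1 - q powi m / t)
     * ((1 - q powi (a - b) * t * x) / (1 - q powi (a - b) * x))
     * ((1 - q powi (2 * m + a - b + 1) * (1 / t) * x) / (1 - q powi (m + a - b + 1) * x))"
  shows "c m a b - c (m - 1) a b - c m a (b - 1)
       + \<alpha> (m - 1) a (b - 1) * c (m - 1) a (b - 1)
       - \<alpha> m (a - 1) b * c m (a - 1) b
       + c (m - 2) a (b - 1) + c m (a - 1) (b - 1)
       - c (m - 1) (a - 1) (b - 1)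
    = c m a b * LS_det1 (q powi m) (q powi (a - b) * x)
      * LS_det2 (q powi a) (q powi b) (q powi (a - b) * x)"
proof -
  define A B C Z where ABC: "A = q powi m" "B = q powi a" "C = q powi b" "Z = q powi (a - b) * x"
  define w where "w = LS_det1 A Z"
  have n: "t \<noteq> A" "q * t \<noteq> A" "t \<noteq> A * Z" "t \<noteq> q * A * Z" "t \<noteq> q * Z" "q * Z \<noteq> 1" "q * A * Z \<noteq> 1"
    "A * Z \<noteq> 1" "Z \<noteq> 1" "t * Z \<noteq> 1" "q \<noteq> t * Z" "q \<noteq> Z"
    using q_powi_neq(1)[of m] q_powi_neq(1)[of "m - 1"] q_powi_neq(5,6)[of "m + (a - b)"]
      q_powi_neq(5,6)[of "1 + (m + (a - b))"] q_powi_neq(5,6)[of "1 + (a - b)"]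
      q_powi_neq(5,7)[of "a - b"] q_powi_neq(5,7)[of "a - b - 1"] nonzero
    by (auto simp: ABC power_int_add power_int_diff field_simps)
  have qZ: "q powi (a - (b - 1)) * x = q * Z" "q powi (a - 1 - b) * x = Z / q"
    "q powi (a - 1 - (b - 1)) * x = Z" "q powi (m - 1) = A / q" "q powi (a - b) * x = Z"
    using nonzero by (simp_all add: ABC power_int_diff)
  have w: "1 - t * (1 - A) * (1 - A * Z) / ((t - A) * (t - A * Z)) = w"
    unfolding w_def LS_det1_def using shift12_ratio_identity n by blast
  have c1: "c m a b - c (m - 1) a b = w * c m a b"
    unfolding w[symmetric] c_shift12[of m a b] qZ ABC(1)[symmetric]
    by (simp add: left_diff_distrib)
  have c7: "c m (a - 1) (b - 1) - c (m - 1) (a - 1) (b - 1) = w * c m (a - 1) (b - 1)"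
    unfolding w[symmetric] c_shift12[of m "a - 1" "b - 1"] qZ ABC(1)[symmetric]
    by (simp add: left_diff_distrib)
  have c2: "c m a (b - 1) = eta2 C * ((1 - t * Z) / (1 - Z))
     * ((t - q * A * Z) * (1 - q * Z) / ((t - q * Z) * (1 - q * A * Z))) * c m a b"
    unfolding c_shift23[of m a b] eta2_def ABC ..
  have c3: "c (m - 1) a (b - 1) =
      t * (1 - A) * (1 - q * A * Z) / ((t - A) * (t - q * A * Z)) * c m a (b - 1)"
    unfolding c_shift12[of m a "b - 1"] qZ ABC(1)[symmetric] by (simp add: mult_ac)
  have c4: "c (m - 2) a (b - 1) =
      t * (q - A) * (1 - A * Z) / ((q * t - A) * (t - A * Z)) * c (m - 1) a (b - 1)"
  proof -
    have "c (m - 2) a (b - 1) =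
      t * (1 - A / q) * (1 - A * Z) / ((t - A / q) * (t - A * Z)) * c (m - 1) a (b - 1)"
      using c_shift12[of "m - 1" a "b - 1"] nonzero unfolding qZ by simp
    moreover have "1 - A / q = (q - A) / q" "t - A / q = (q * t - A) / q"
      using nonzero by (simp_all add: diff_divide_distrib)
    ultimately show ?thesis
      using nonzero by (simp add: mult_ac)
  qed
  have \<alpha>1: "\<alpha> (m - 1) a (b - 1) = (t - 1) * q / (q * t - A) * ((1 - q * t * Z) / (1 - q * Z))
      * ((t - A^2 * Z) / (t * (1 - q * A * Z)))"
  proof -
    have e: "q powi (2 * (m - 1) + a - (b - 1) + 1) = A^2 * q powi (a - b)"
      "q powi (m - 1 + a - (b - 1) + 1) = q * A * q powi (a - b)"
      "q powi (a - (b - 1)) = q * q powi (a - b)"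
    proof -
      have "2 * (m - 1) + a - (b - 1) + 1 = (m + m) + (a - b)"
        "m - 1 + a - (b - 1) + 1 = (1 + m) + (a - b)" "a - (b - 1) = 1 + (a - b)"
        by simp_all
      then show "q powi (2 * (m - 1) + a - (b - 1) + 1) = A^2 * q powi (a - b)"
        "q powi (m - 1 + a - (b - 1) + 1) = q * A * q powi (a - b)"
        "q powi (a - (b - 1)) = q * q powi (a - b)"
        by (simp_all only: q_powi_add ABC power2_eq_square power_int_1_right)
    qed
    have "1 - 1 / t = (t - 1) / t" "1 - A / q / t = (q * t - A) / (q * t)"
      "1 - A^2 * Z / t = (t - A^2 * Z) / t"
      using nonzero by (simp_all add: diff_divide_distrib)
    then show ?thesis
      unfolding \<alpha>_def qZ e using nonzero by (simp add: ABC(4) mult_ac)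
  qed
  have \<alpha>2: "\<alpha> m (a - 1) b =
      (t - 1) / (t - A) * ((q - t * Z) / (q - Z)) * ((t - A^2 * Z) / (t * (1 - A * Z)))"
  proof -
    have e: "q powi (2 * m + (a - 1) - b + 1) = A^2 * q powi (a - b)"
      "q powi (m + (a - 1) - b + 1) = A * q powi (a - b)"
      "q powi (a - 1 - b) = q powi (a - b) / q"
    proof -
      have "2 * m + (a - 1) - b + 1 = (m + m) + (a - b)" "m + (a - 1) - b + 1 = m + (a - b)"
        "a - 1 - b = (a - b) - 1"
        by simp_all
      then show "q powi (2 * m + (a - 1) - b + 1) = A^2 * q powi (a - b)"
        "q powi (m + (a - 1) - b + 1) = A * q powi (a - b)"
        "q powi (a - 1 - b) = q powi (a - b) / q"
        using nonzero
        by (simp_all only: q_powi_add ABC power2_eq_square power_int_diff power_int_1_right simp_thms)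
    qed
    have "1 - 1 / t = (t - 1) / t" "1 - A / t = (t - A) / t"
      "1 - A^2 * Z / t = (t - A^2 * Z) / t" "1 - Z / q = (q - Z) / q" "1 - t * Z / q = (q - t * Z) / q"
      using nonzero by (simp_all add: diff_divide_distrib)
    then show ?thesis
      unfolding \<alpha>_def e ABC(1)[symmetric] using nonzero by (simp add: ABC(4) mult_ac)
  qed
  \<comment> \<open>A single term has to produce \<open>w\<close>: here \<alpha> supplies it, and
    its factor in \<open>q - t * Z\<close> and \<open>q - Z\<close> cancels against the shift
    ratio.\<close>
  have c5: "\<alpha> m (a - 1) b * c m (a - 1) b = w * eta1 B * ((t - Z) / (1 - Z)) * c m a b"
    unfolding \<alpha>2 c_shift13[of m a b] w_def LS_det1_def eta1_def ABC(1,2,4)[symmetric]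
    using n nonzero by (simp add: mult_ac)
  \<comment> \<open>After \<open>b\<close> is lowered, \<open>c_shift13\<close> applies with
    \<open>q * Z\<close> for \<open>Z\<close>. Its factor in \<open>Z\<close> is then the reciprocal
    of that in \<open>c2\<close>, which leaves only \<open>t\<close>.\<close>
  have c6: "c m (a - 1) (b - 1) = t * eta1 B * eta2 C * c m a b"
  proof -
    have "A * (q * Z) = q * A * Z" "q - q * Z = q * (1 - Z)" "q - t * (q * Z) = q * (1 - t * Z)"
      by (simp_all add: right_diff_distrib mult_ac)
    note * = this
    show ?thesis
      unfolding c_shift13[of m a "b - 1"] c2 eta1_def qZ ABC(1,2)[symmetric]
      unfolding * using n nonzero by (simp add: mult_ac)
  qed
  \<comment> \<open>All three terms are multiples of \<open>c m a (b - 1)\<close>, which equals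
    \<open>s * r4\<close> below; what multiplies \<open>s\<close> is the left-hand side of
    \<open>shift23_ratio_identity\<close>.\<close>
  have c8: "c m a (b - 1) - \<alpha> (m - 1) a (b - 1) * c (m - 1) a (b - 1) - c (m - 2) a (b - 1)
     = w * eta2 C * ((1 - t * Z) / (1 - Z)) * c m a b"
  proof -
    define r1 r2 r3 r4 s where r: "r1 = \<alpha> (m - 1) a (b - 1)"
      "r2 = t * (1 - A) * (1 - q * A * Z) / ((t - A) * (t - q * A * Z))"
      "r3 = t * (q - A) * (1 - A * Z) / ((q * t - A) * (t - A * Z))"
      "r4 = (t - q * A * Z) * (1 - q * Z) / ((t - q * Z) * (1 - q * A * Z))"
      "s = eta2 C * ((1 - t * Z) / (1 - Z)) * c m a b"
    have "r4 * (1 - r1 * r2 - r3 * r2) = w"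
      unfolding r \<alpha>1 w_def LS_det1_def using shift23_ratio_identity[of t A q Z] n nonzero by blast
    moreover have "c m a (b - 1) - r1 * c (m - 1) a (b - 1) - c (m - 2) a (b - 1)
      = s * (r4 * (1 - r1 * r2 - r3 * r2))"
      unfolding c4 c3 r(2,3)[symmetric] c2 r(4)[symmetric] unfolding r(5) by Groebner_Basis.algebra
    ultimately show ?thesis
      unfolding r(1)[symmetric] by (simp add: r(5) mult_ac)
  qed
  have "c m a b - c (m - 1) a b - c m a (b - 1)
       + \<alpha> (m - 1) a (b - 1) * c (m - 1) a (b - 1) - \<alpha> m (a - 1) b * c m (a - 1) b
       + c (m - 2) a (b - 1) + c m (a - 1) (b - 1) - c (m - 1) (a - 1) (b - 1)
    = (c m a b - c (m - 1) a b)
      - (c m a (b - 1) - \<alpha> (m - 1) a (b - 1) * c (m - 1) a (b - 1) - c (m - 2) a (b - 1))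
      - \<alpha> m (a - 1) b * c m (a - 1) b + (c m (a - 1) (b - 1) - c (m - 1) (a - 1) (b - 1))"
    by simp
  also have "\<dots> = c m a b * w * LS_det2 B C Z"
    unfolding c1 c8 c5 c7 unfolding c6 LS_det2_def by (simp add: algebra_simps)
  finally show ?thesis
    unfolding w_def ABC .
qed

lemma c_tilde_eq_LS_fun:
  assumes "x = s1 / s2" "y = s1 / s3" "z = s2 / s3"
  shows "c_tilde q t s1 s2 s3 (int m) (int a) (int b) =
    LS_fun q t [m] [q powi (int a - int b) * (1 / t) * x]
    * LS_fun q t [a, b] [(1 / t) * y, (1 / t) * z]"
proof -
  have u: "q powi (int a - int b) * (1 / t) * x = q powi (int a - int b) * x / t"
    "(1 / t) * y = y / t" "(1 / t) * z = z / t"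
    by simp_all
  have "c (int m) (int a) (int b) = t ^ m * t ^ a * t ^ b
     * (qratio q t q m * qratio q t (q powi (int a - int b) * x * q) m)
     * (qratio q t q a * qratio q t (y * q) a * qratio q t (x * q) a
        / qratio q t (t * x * q powi (- int b)) a)
     * (qratio q t q b * qratio q t (z * q) b)"
    by (simp add: c_def c_nat_def power_add)
  then show ?thesis
    unfolding c_tilde_def Let_def c_coeff_eq[OF assms] \<alpha>_coeff_def assms(1)[symmetric] c_combination
      u LS_fun_1_eq LS_fun_2_eq
    by (simp add: mult_ac)
qed

end

section \<open>Specialization to the field of rational functions\<close>

lemma powi_ratio_mult:
  fixes u v w :: "'a::field"
  assumes "v \<noteq> 0"
  shows "(u / v) powi m * (v / w) powi n = u powi m * v powi (n - m) * w powi (- n)"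
  using assms by (simp add: power_int_divide_distrib power_int_diff power_int_minus field_simps)

theorem proposition6p2:
  fixes q t s1 s2 s3 :: "'k::field ratfun5"
    and \<theta>12 \<theta>13 \<theta>23 :: nat
  assumes "q = ind_q" and "t = ind_t" and "s1 = ind_s1" and "s2 = ind_s2" and "s3 = ind_s3"
  shows "c_tilde q t s1 s2 s3 (int \<theta>12) (int \<theta>13) (int \<theta>23) =
    LS_fun q t [\<theta>12] [q powi (int \<theta>13 - int \<theta>23) * (1 / t) * (s1 / s2)]
    * LS_fun q t [\<theta>13, \<theta>23] [(1 / t) * (s1 / s3), (1 / t) * (s2 / s3)]"
proof -
  have nz: "q \<noteq> 0" "t \<noteq> 0" "s1 \<noteq> 0" "s2 \<noteq> 0" "s3 \<noteq> 0"
    unfolding assms by (rule ind_nonzero)+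
  \<comment> \<open>A monomial in \<open>s1 / s2\<close> and \<open>s2 / s3\<close> has exponents
    \<open>c\<close>, \<open>d - c\<close>, \<open>- d\<close> in \<open>s1\<close>,
    \<open>s2\<close>, \<open>s3\<close>, all zero only if \<open>c = d = 0\<close>. Independence
    thus passes from the five indeterminates to \<open>q\<close>, \<open>t\<close> and the two
    ratios.\<close>
  interpret generic_parameters q t "s1 / s2" "s1 / s3" "s2 / s3"
  proof
    fix a b c d :: int
    assume "q powi a * t powi b * (s1 / s2) powi c * (s2 / s3) powi d = 1"
    moreover have "(s1 / s2) powi c * (s2 / s3) powi d = s1 powi c * s2 powi (d - c) * s3 powi (- d)"
      by (rule powi_ratio_mult[OF nz(4)])
    ultimately have "q powi a * t powi b * s1 powi c * s2 powi (d - c) * s3 powi (- d) = 1"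
      by (simp only: mult.assoc)
    then have "a = 0 \<and> b = 0 \<and> c = 0 \<and> d - c = 0 \<and> - d = 0"
      unfolding assms by (rule ind_independent)
    then show "a = 0 \<and> b = 0 \<and> c = 0 \<and> d = 0"
      by simp
  qed (use nz in simp_all)
  show ?thesis
    by (rule c_tilde_eq_LS_fun) (rule refl)+
qed

end
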